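(* Let $X$ be a perturbable compact metric space with metric $d$ and let $f\in\mathcal C(X)$. The dynamical system $(X,f)$ has shadowing if and only if for every $\epsilon>0$ there exists $\delta>0$ such that if $g\in\mathcal C(X)$ with $\rho(g,f)<\delta$, then each $g$-orbit is $\epsilon$-shadowed by an $f$-orbit.
   Context: $\mathcal C(X)$ is the set of continuous functions $X\to X$, with the supremum metric $\rho(f,g)=\sup_{x\in X}d(f(x),g(x))$; the same notation $\rho(g_0,f|_F)=\sup_{x\in F}d(g_0(x),f(x))$ is used for functions defined on a subset $F\subseteq X$. $\omega=\{0,1,2,\dots\}$. A metric space $X$ is perturbable if for all $\epsilon>0$ there exists $\delta>0$ such that for every continuous $f:X\to X$, every finite subset $F\subseteq X$, and every function $g_0:F\to X$ with $\rho(g_0,f|_F)<\delta$, there exists a continuous $g:X\to X$ with $\rho(f,g)<\epsilon$ and $g|_F=g_0$. For a function $h:X\to X$ and $x\in X$, the $h$-orbit of $x$ is the sequence $\langle h^i(x)\rangle_{i\in\omega}$, where $h^0$ is the identity. For $\delta>0$, a $\delta$-pseudo-orbit for $f$ is a sequence $\langle x_i\rangle_{i\in\omega}$ in $X$ with $d(f(x_i),x_{i+1})<\delta$ for all $i\in\omega$. A sequence $\langle x_i\rangle_{i\in\omega}$ $\epsilon$-shadows a sequence $\langle y_i\rangle_{i\in\omega}$ if $d(x_i,y_i)<\epsilon$ for all $i\in\omega$. The system $(X,f)$ has shadowing if for all $\epsilon>0$ there exists $\delta>0$ such that for every $\delta$-pseudo-orbit $\langle x_i\rangle$ for $f$ there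 exists $z\in X$ with $d(x_i,f^i(z))<\epsilon$ for all $i\in\omega$. *)

theory Defs
  imports "HOL-Analysis.Analysis"
begin

text \<open>
  The space is a subset \<open>X\<close> of a metric-space type, with the metric \<^const>\<open>dist\<close> restricted to \<open>X\<close>.
  Self-maps of \<open>X\<close> are total functions of which only the values on \<open>X\<close> matter.
\<close>

definition cont_self_maps :: "'a::metric_space set \<Rightarrow> ('a \<Rightarrow> 'a) set"
  where "cont_self_maps X = {f. continuous_on X f \<and> f ` X \<subseteq> X}"

text \<open>
  The supremum is taken in \<^typ>\<open>ennreal\<close>, so that it is \<open>0\<close> over the empty set and \<open>\<infinity>\<close> if the
  distances are unbounded, as can happen when \<open>X\<close> is not compact.
\<close>

definition sup_dist :: "'a set \<Rightarrow> ('a \<Rightarrow> 'b::metric_space) \<Rightarrow> ('a \<Rightarrow> 'b) \<Rightarrow> ennreal"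
  where "sup_dist S f g = (SUP x\<in>S. ennreal (dist (f x) (g x)))"

definition perturbable :: "'a::metric_space set \<Rightarrow> bool"
  where "perturbable X \<longleftrightarrow>
    (\<forall>\<epsilon>::real. \<epsilon> > 0 \<longrightarrow>
      (\<exists>\<delta>::real. \<delta> > 0 \<and>
        (\<forall>f \<in> cont_self_maps X. \<forall>F g0.
          finite F \<and> F \<subseteq> X \<and> g0 ` F \<subseteq> X \<and> sup_dist F g0 f < ennreal \<delta> \<longrightarrow>
          (\<exists>g \<in> cont_self_maps X. sup_dist X f g < ennreal \<epsilon> \<and> (\<forall>x\<in>F. g x = g0 x)))))"

definition orbit_seq :: "('a \<Rightarrow> 'a) \<Rightarrow> 'a \<Rightarrow> nat \<Rightarrow> 'a"
  where "orbit_seq h x = (\<lambda>i. (h ^^ i) x)"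

definition pseudo_orbit :: "'a::metric_space set \<Rightarrow> ('a \<Rightarrow> 'a) \<Rightarrow> real \<Rightarrow> (nat \<Rightarrow> 'a) \<Rightarrow> bool"
  where "pseudo_orbit X f \<delta> x \<longleftrightarrow>
    (\<forall>i. x i \<in> X) \<and> (\<forall>i. dist (f (x i)) (x (Suc i)) < \<delta>)"

definition shadows :: "real \<Rightarrow> (nat \<Rightarrow> 'a::metric_space) \<Rightarrow> (nat \<Rightarrow> 'a) \<Rightarrow> bool"
  where "shadows \<epsilon> x y \<longleftrightarrow> (\<forall>i. dist (x i) (y i) < \<epsilon>)"

definition has_shadowing :: "'a::metric_space set \<Rightarrow> ('a \<Rightarrow> 'a) \<Rightarrow> bool"
  where "has_shadowing X f \<longleftrightarrow>
    (\<forall>\<epsilon>::real. \<epsilon> > 0 \<longrightarrow>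
      (\<exists>\<delta>::real. \<delta> > 0 \<and>
        (\<forall>x. pseudo_orbit X f \<delta> x \<longrightarrow> (\<exists>z\<in>X. \<forall>i. dist (x i) ((f ^^ i) z) < \<epsilon>))))"

end

theory Submission
  imports Defs
begin

text \<open>
  If \<open>f\<close> has shadowing and \<open>g\<close> is uniformly close to \<open>f\<close>, then every \<open>g\<close>-orbit is a pseudo-orbit
  of \<open>f\<close> and hence is shadowed.

  For the converse, perturbability realises a finite piece of a pseudo-orbit as an orbit of some \<open>g\<close>
  near \<open>f\<close>, but only if the piece is \<^emph>\<open>deterministic\<close>: whenever it visits a point twice, it must
  move on to the same point both times (\<open>perturbable_imp_orbit_segment\<close>). So, under the stability
  hypothesis, deterministic pieces are shadowed, and by compactness (\<open>shadowing_from_finite_segments\<close>)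
  it is enough to replace each pseudo-orbit by a nearby one whose initial pieces are deterministic.

  At a point with infinitely many other points of \<open>X\<close> within distance \<open>\<eta>\<close> this is easy: the visits can
  be moved apart by less than \<open>\<eta>\<close>. The remaining points form a finite set \<open>P\<close> of isolated points
  (\<open>finite_sparse_points\<close>), and a second visit to some \<open>p\<close> in \<open>P\<close> cannot be perturbed away. Here the
  dichotomy \<open>isolated_point_dichotomy\<close> helps, in which the size of the jumps may depend on \<open>p\<close>.

  \<^item> If \<open>p\<close> is not periodic under \<open>f\<close>, then pseudo-orbits with small jumps never return to \<open>p\<close>. A
    shortest returning piece would visit distinct points, hence be deterministic, hence be shadowed by
    an \<open>f\<close>-orbit; as \<open>p\<close> is isolated, this \<open>f\<close>-orbit would start at \<open>p\<close> and return to \<open>p\<close>.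
  \<^item> If \<open>p\<close> is periodic, then pseudo-orbits with small jumps starting at \<open>p\<close> stay close to the
    \<open>f\<close>-orbit of \<open>p\<close> for ever: over one period this is continuity, and after one period they are
    exactly back at \<open>p\<close>, so errors do not accumulate.

  Since \<open>P\<close> is finite, one jump size serves all its points. A pseudo-orbit is then replaced by the true
  orbit from its first visit to a periodic point of \<open>P\<close> on (\<open>exact_after_repeats\<close>); before that time
  it visits no point of \<open>P\<close> that it visits again, and all its other points can be moved apart
  (\<open>deterministic_approximation\<close>).
\<close>

section \<open>Iterates and pseudo-orbits\<close>

definition pseudo_orbit_segment ::
    "'a::metric_space set \<Rightarrow> ('a \<Rightarrow> 'a) \<Rightarrow> real \<Rightarrow> nat \<Rightarrow> (nat \<Rightarrow> 'a) \<Rightarrow> bool"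
  where "pseudo_orbit_segment X f \<delta> n x \<longleftrightarrow>
    (\<forall>i\<le>n. x i \<in> X) \<and> (\<forall>i<n. dist (f (x i)) (x (Suc i)) < \<delta>)"

definition deterministic :: "nat \<Rightarrow> (nat \<Rightarrow> 'a) \<Rightarrow> bool"
  where "deterministic n x \<longleftrightarrow> (\<forall>i<n. \<forall>j<n. x i = x j \<longrightarrow> x (Suc i) = x (Suc j))"

text \<open>
  What perturbability and the stability of orbits under perturbation give together: an orbit of a map
  is deterministic, so this is as much of shadowing as perturbing the map can reach directly.
\<close>

definition deterministic_shadowing :: "'a::metric_space set \<Rightarrow> ('a \<Rightarrow> 'a) \<Rightarrow> bool"
  where "deterministic_shadowing X f \<longleftrightarrow>
    (\<forall>\<epsilon>>0. \<exists>\<delta>>0. \<forall>n x. pseudo_orbit_segment X f \<delta> n x \<and> deterministic n x \<longrightarrow>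
      (\<exists>z\<in>X. \<forall>i\<le>n. dist ((f ^^ i) z) (x i) < \<epsilon>))"

definition periodic_point :: "('a \<Rightarrow> 'a) \<Rightarrow> 'a \<Rightarrow> bool"
  where "periodic_point f p \<longleftrightarrow> (\<exists>k>0. (f ^^ k) p = p)"

lemma funpow_mem: "f ` X \<subseteq> X \<Longrightarrow> p \<in> X \<Longrightarrow> (f ^^ i) p \<in> X"
  by (induction i) auto

lemma continuous_on_funpow:
  assumes "continuous_on X f" "f ` X \<subseteq> X"
  shows "continuous_on X (f ^^ i)"
proof (induction i)
  case (Suc i)
  have "(f ^^ i) ` X \<subseteq> X"
    using funpow_mem[OF assms(2)] by auto
  then have "continuous_on ((f ^^ i) ` X) f"
    using assms(1) continuous_on_subset by blast
  then show ?case
    using continuous_on_compose[OF Suc] by simp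
qed (simp add: id_def)

lemma funpow_mult_period:
  assumes "(f ^^ k) p = p"
  shows "(f ^^ (m * k)) p = p"
  by (induction m) (simp_all add: funpow_add assms)

lemma pseudo_orbit_shift:
  "pseudo_orbit X f \<delta> x \<Longrightarrow> pseudo_orbit X f \<delta> (\<lambda>i. x (m + i))"
  by (simp add: pseudo_orbit_def)

lemma pseudo_orbit_mono:
  "pseudo_orbit X f \<delta> x \<Longrightarrow> \<delta> \<le> \<delta>' \<Longrightarrow> pseudo_orbit X f \<delta>' x"
  unfolding pseudo_orbit_def by (meson less_le_trans)

lemma sup_dist_lessI:
  assumes "\<And>x. x \<in> S \<Longrightarrow> dist (f x) (g x) \<le> c" "c < d" "0 < d"
  shows "sup_dist S f g < ennreal d"
proof -
  have "sup_dist S f g \<le> ennreal c"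
    unfolding sup_dist_def using assms(1) by (auto intro!: SUP_least ennreal_leI)
  also have "\<dots> < ennreal d"
    using assms(2,3) by (simp add: ennreal_lessI)
  finally show ?thesis .
qed

lemma sup_dist_lessD:
  assumes "sup_dist S f g < ennreal d" "x \<in> S"
  shows "dist (f x) (g x) < d"
proof -
  have "ennreal (dist (f x) (g x)) \<le> sup_dist S f g"
    unfolding sup_dist_def using assms(2) by (rule SUP_upper)
  then have "ennreal (dist (f x) (g x)) < ennreal d"
    using assms(1) by simp
  then show ?thesis
    by (simp add: ennreal_less_iff)
qed

lemma sup_dist_commute: "sup_dist S f g = sup_dist S g f"
  by (simp add: sup_dist_def dist_commute)

section \<open>Deterministic pseudo-orbits\<close>

text \<open>
  Determinism makes \<open>x i \<mapsto> x (Suc i)\<close> a well-defined function \<open>g0\<close> on the finitely many points visited.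
  It is close to \<open>f\<close> there, so perturbability extends it to a continuous map.
\<close>

lemma perturbable_imp_orbit_segment:
  assumes "perturbable X" "f \<in> cont_self_maps X" "\<epsilon> > 0"
  obtains \<delta> where "\<delta> > 0"
    "\<And>n x. pseudo_orbit_segment X f \<delta> n x \<Longrightarrow> deterministic n x \<Longrightarrow>
      \<exists>g\<in>cont_self_maps X. sup_dist X g f < ennreal \<epsilon> \<and> (\<forall>i\<le>n. (g ^^ i) (x 0) = x i)"
proof -
  obtain \<delta> where \<delta>: "\<delta> > 0"
    and ext: "\<forall>f \<in> cont_self_maps X. \<forall>F g0.
      finite F \<and> F \<subseteq> X \<and> g0 ` F \<subseteq> X \<and> sup_dist F g0 f < ennreal \<delta> \<longrightarrow>
      (\<exists>g \<in> cont_self_maps X. sup_dist X f g < ennreal \<epsilon> \<and> (\<forall>x\<in>F. g x = g0 x))"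
    using assms(1)[unfolded perturbable_def, rule_format, OF assms(3)] by (elim exE conjE)
  show thesis
  \<comment> \<open>half of \<open>\<delta>\<close>, so that pointwise bounds give a strict bound for the supremum\<close>
  proof (rule that[of "\<delta> / 2"])
    fix n x
    assume seg: "pseudo_orbit_segment X f (\<delta> / 2) n x" and det: "deterministic n x"
    define g0 where "g0 v = x (Suc (SOME i. i < n \<and> x i = v))" for v
    have g0: "g0 (x i) = x (Suc i)" if "i < n" for i
    proof -
      have "(SOME j. j < n \<and> x j = x i) < n \<and> x (SOME j. j < n \<and> x j = x i) = x i"
        by (rule someI[of _ i]) (use that in simp)
      then show ?thesis
        using det that unfolding deterministic_def g0_def by blast
    qed
    have "sup_dist (x ` {..<n}) g0 f < ennreal \<delta>"
    proof (rule sup_dist_lessI[of _ _ _ "\<delta> / 2"])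
      fix v assume "v \<in> x ` {..<n}"
      then show "dist (g0 v) (f v) \<le> \<delta> / 2"
        using seg g0 by (auto simp: pseudo_orbit_segment_def dist_commute less_imp_le)
    qed (use \<delta> in auto)
    moreover have "x ` {..<n} \<subseteq> X" "g0 ` (x ` {..<n}) \<subseteq> X"
      using seg g0 by (auto simp: pseudo_orbit_segment_def)
    ultimately obtain g where g: "g \<in> cont_self_maps X" "sup_dist X f g < ennreal \<epsilon>"
        "\<forall>v\<in>x ` {..<n}. g v = g0 v"
      using ext[rule_format, OF assms(2), of "x ` {..<n}" g0] by auto
    have "(g ^^ i) (x 0) = x i" if "i \<le> n" for i
      using that by (induction i) (use g(3) g0 in auto)
    then show "\<exists>g\<in>cont_self_maps X. sup_dist X g f < ennreal \<epsilon> \<and> (\<forall>i\<le>n. (g ^^ i) (x 0) = x i)"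
      using g sup_dist_commute[of X f g] by auto
  qed (use \<delta> in auto)
qed

lemma deterministic_shadowingI:
  assumes "perturbable X" "f \<in> cont_self_maps X"
    and stable: "\<And>\<epsilon>. \<epsilon> > 0 \<Longrightarrow> \<exists>\<delta>>0. \<forall>g\<in>cont_self_maps X. sup_dist X g f < ennreal \<delta> \<longrightarrow>
          (\<forall>y\<in>X. \<exists>z\<in>X. shadows \<epsilon> (orbit_seq f z) (orbit_seq g y))"
  shows "deterministic_shadowing X f"
  unfolding deterministic_shadowing_def
proof (intro allI impI)
  fix \<epsilon> :: real assume "\<epsilon> > 0"
  then obtain \<delta> where \<delta>: "\<delta> > 0" "\<And>g y. g \<in> cont_self_maps X \<Longrightarrow> sup_dist X g f < ennreal \<delta> \<Longrightarrow>
      y \<in> X \<Longrightarrow> \<exists>z\<in>X. shadows \<epsilon> (orbit_seq f z) (orbit_seq g y)"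
    using stable by meson
  obtain \<delta>' where \<delta>': "\<delta>' > 0"
    "\<And>n x. pseudo_orbit_segment X f \<delta>' n x \<Longrightarrow> deterministic n x \<Longrightarrow>
      \<exists>g\<in>cont_self_maps X. sup_dist X g f < ennreal \<delta> \<and> (\<forall>i\<le>n. (g ^^ i) (x 0) = x i)"
    using perturbable_imp_orbit_segment[OF assms(1,2) \<delta>(1)] by blast
  have "\<exists>z\<in>X. \<forall>i\<le>n. dist ((f ^^ i) z) (x i) < \<epsilon>"
    if x: "pseudo_orbit_segment X f \<delta>' n x" "deterministic n x" for n x
  proof -
    obtain g where g: "g \<in> cont_self_maps X" "sup_dist X g f < ennreal \<delta>"
        "\<forall>i\<le>n. (g ^^ i) (x 0) = x i"
      using \<delta>'(2)[OF x] by blast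
    have "x 0 \<in> X"
      using x(1) by (auto simp: pseudo_orbit_segment_def)
    then obtain z where "z \<in> X" "shadows \<epsilon> (orbit_seq f z) (orbit_seq g (x 0))"
      using \<delta>(2) g by blast
    then show ?thesis
      using g(3) unfolding shadows_def orbit_seq_def by metis
  qed
  then show "\<exists>\<delta>>0. \<forall>n x. pseudo_orbit_segment X f \<delta> n x \<and> deterministic n x \<longrightarrow>
      (\<exists>z\<in>X. \<forall>i\<le>n. dist ((f ^^ i) z) (x i) < \<epsilon>)"
    using \<delta>'(1) by blast
qed

section \<open>Pseudo-orbits through isolated points\<close>

text \<open>
  Cutting out the loop between two visits to the same point leaves a shorter piece with the same ends.
\<close>

lemma shortest_return_inj:
  assumes "\<exists>n>0. \<exists>x. pseudo_orbit_segment X f \<delta> n x \<and> x 0 = p \<and> x n = p"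
  obtains n x where "n > 0" "pseudo_orbit_segment X f \<delta> n x" "x 0 = p" "x n = p"
    "inj_on x {..<n}"
proof -
  define Q where "Q n \<longleftrightarrow> n > 0 \<and> (\<exists>x. pseudo_orbit_segment X f \<delta> n x \<and> x 0 = p \<and> x n = p)" for n
  define n where "n = (LEAST n. Q n)"
  have "Q n"
    unfolding n_def using assms LeastI_ex[of Q] by (auto simp: Q_def)
  then obtain x where n: "n > 0" and x: "pseudo_orbit_segment X f \<delta> n x" "x 0 = p" "x n = p"
    by (auto simp: Q_def)
  have False if ij: "i < j" "j < n" "x i = x j" for i j
  proof -
    define x' where "x' m = (if m \<le> i then x m else x (m + (j - i)))" for m
    define n' where "n' = n - (j - i)"
    have n': "0 < n'" "i < n'" "n' < n" "n' + (j - i) = n"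
      using ij by (auto simp: n'_def)
    have "dist (f (x' m)) (x' (Suc m)) < \<delta>" if "m < n'" for m
    proof -
      \<comment> \<open>at the cut \<open>m = i\<close> the jump is the one made by \<open>x\<close> at time \<open>j\<close>\<close>
      consider "m < i" | "m = i" | "m > i" by linarith
      then show ?thesis
        using x(1) that n' ij by cases (auto simp: x'_def pseudo_orbit_segment_def)
    qed
    moreover have "x' m \<in> X" if "m \<le> n'" for m
      using x(1) that n' by (auto simp: x'_def pseudo_orbit_segment_def)
    ultimately have "pseudo_orbit_segment X f \<delta> n' x'" "x' 0 = p" "x' n' = p"
      using x n' by (auto simp: pseudo_orbit_segment_def x'_def)
    then have "Q n'"
      using n' by (auto simp: Q_def)
    then show False
      using n' not_less_Least[of n' Q] by (simp add: n_def)
  qed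
  then have "inj_on x {..<n}"
    by (intro inj_onI) (metis lessThan_iff linorder_neqE_nat)
  then show thesis
    using that n x by blast
qed

text \<open>
  An \<open>f\<close>-orbit that shadows a return to \<open>p\<close> more closely than the isolation radius \<open>r\<close> of \<open>p\<close> passes
  through \<open>p\<close> itself at both ends. The shortest return for a given jump size is deterministic, because
  it visits no point twice, and so is shadowed.
\<close>

lemma isolated_return_imp_periodic:
  assumes "deterministic_shadowing X f"
    and "r > 0" "\<And>z. z \<in> X \<Longrightarrow> dist z p < r \<Longrightarrow> z = p"
    and self: "f ` X \<subseteq> X"
  shows "\<exists>\<delta>>0. \<forall>n x. n > 0 \<and> pseudo_orbit_segment X f \<delta> n x \<and> x 0 = p \<and> x n = p \<longrightarrow>
    periodic_point f p"
proof -
  obtain \<delta> where \<delta>: "\<delta> > 0" "\<And>n x. pseudo_orbit_segment X f \<delta> n x \<Longrightarrow> deterministic n x \<Longrightarrow>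
      \<exists>z\<in>X. \<forall>i\<le>n. dist ((f ^^ i) z) (x i) < r"
    using assms(1,2) unfolding deterministic_shadowing_def by meson
  show ?thesis
  proof (intro exI[of _ \<delta>] conjI allI impI \<delta>(1))
    fix m y assume "m > 0 \<and> pseudo_orbit_segment X f \<delta> m y \<and> y 0 = p \<and> y m = p"
    then obtain n x where n: "n > 0" and x: "pseudo_orbit_segment X f \<delta> n x" "x 0 = p" "x n = p"
        "inj_on x {..<n}"
      using shortest_return_inj[of X f \<delta> p] by blast
    have "deterministic n x"
      using x(4) by (auto simp: deterministic_def inj_on_def)
    then obtain z where z: "z \<in> X" "\<forall>i\<le>n. dist ((f ^^ i) z) (x i) < r"
      using \<delta>(2) x(1) by blast
    have "dist ((f ^^ 0) z) (x 0) < r" "dist ((f ^^ n) z) (x n) < r"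
      using z(2) by blast+
    then have "z = p" "(f ^^ n) z = p"
      using assms(3) z(1) x(2,3) funpow_mem[OF self z(1)] by auto
    then show "periodic_point f p"
      using n by (auto simp: periodic_point_def)
  qed
qed

text \<open>
  Since the starting point is fixed, continuity of \<open>f\<close> at the points of its orbit suffices.
\<close>

lemma finite_time_tracking:
  assumes "f \<in> cont_self_maps X" "p \<in> X" "\<epsilon> > 0"
  shows "\<exists>\<delta>>0. \<forall>x. pseudo_orbit X f \<delta> x \<and> x 0 = p \<longrightarrow> (\<forall>i\<le>K. dist (x i) ((f ^^ i) p) < \<epsilon>)"
  using assms(3)
proof (induction K arbitrary: \<epsilon>)
  case 0
  then show ?case
    by (intro exI[of _ 1]) auto
next
  case (Suc K)
  have f: "continuous_on X f" "f ` X \<subseteq> X"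
    using assms(1) by (auto simp: cont_self_maps_def)
  have "(f ^^ K) p \<in> X"
    by (rule funpow_mem[OF f(2) assms(2)])
  then obtain d where d: "d > 0" "\<And>v. v \<in> X \<Longrightarrow> dist v ((f ^^ K) p) < d \<Longrightarrow>
      dist (f v) (f ((f ^^ K) p)) < \<epsilon> / 2"
    using f(1) Suc.prems unfolding continuous_on_iff by (meson half_gt_zero)
  obtain \<delta> where \<delta>: "\<delta> > 0" "\<And>x. pseudo_orbit X f \<delta> x \<Longrightarrow> x 0 = p \<Longrightarrow>
      \<forall>i\<le>K. dist (x i) ((f ^^ i) p) < min d \<epsilon>"
    using Suc.IH[of "min d \<epsilon>"] d(1) Suc.prems by auto
  have "\<forall>i\<le>Suc K. dist (x i) ((f ^^ i) p) < \<epsilon>"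
    if x: "pseudo_orbit X f (min \<delta> (\<epsilon> / 2)) x" "x 0 = p" for x
  proof -
    have K: "\<forall>i\<le>K. dist (x i) ((f ^^ i) p) < min d \<epsilon>"
      using \<delta>(2)[of x] x pseudo_orbit_mono[OF x(1), of \<delta>] by auto
    have "dist (f (x K)) (x (Suc K)) < \<epsilon> / 2" "x K \<in> X"
      using x(1) by (auto simp: pseudo_orbit_def)
    moreover have "dist (f (x K)) (f ((f ^^ K) p)) < \<epsilon> / 2"
      using K d(2) \<open>x K \<in> X\<close> by auto
    ultimately have "dist (x (Suc K)) ((f ^^ Suc K) p) < \<epsilon>"
      using dist_triangle_half_r[of "f (x K)" "x (Suc K)" \<epsilon> "f ((f ^^ K) p)"] by simp
    then show ?thesis
      using K by (auto simp: le_Suc_eq)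
  qed
  then show ?case
    using \<delta>(1) Suc.prems by (intro exI[of _ "min \<delta> (\<epsilon> / 2)"]) auto
qed

text \<open>
  Tracking over one period with accuracy below the isolation radius forces the pseudo-orbit to be
  exactly at \<open>p\<close> at the end of the period, where the same argument starts afresh.
\<close>

lemma isolated_periodic_tracking:
  assumes "f \<in> cont_self_maps X" "p \<in> X" "\<epsilon> > 0"
    and "r > 0" "\<And>z. z \<in> X \<Longrightarrow> dist z p < r \<Longrightarrow> z = p"
    and "periodic_point f p"
  shows "\<exists>\<delta>>0. \<forall>x. pseudo_orbit X f \<delta> x \<and> x 0 = p \<longrightarrow> (\<forall>i. dist (x i) ((f ^^ i) p) < \<epsilon>)"
proof -
  obtain k where k: "k > 0" "(f ^^ k) p = p"
    using assms(6) by (auto simp: periodic_point_def)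
  obtain \<delta> where \<delta>: "\<delta> > 0" "\<And>x. pseudo_orbit X f \<delta> x \<Longrightarrow> x 0 = p \<Longrightarrow>
      \<forall>i\<le>k. dist (x i) ((f ^^ i) p) < min \<epsilon> r"
    using finite_time_tracking[OF assms(1,2), of "min \<epsilon> r" k] assms(3,4) by auto
  have "dist (x i) ((f ^^ i) p) < \<epsilon>" if x: "pseudo_orbit X f \<delta> x" "x 0 = p" for x i
  proof -
    have return: "x (m * k) = p" for m
    proof (induction m)
      case (Suc m)
      have "\<forall>i\<le>k. dist (x (m * k + i)) ((f ^^ i) p) < min \<epsilon> r"
        using \<delta>(2)[OF pseudo_orbit_shift[OF x(1)], of "m * k"] Suc by simp
      then have "dist (x (m * k + k)) p < r"
        using k(2) by (metis min_less_iff_conj order_refl)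
      moreover have "x (m * k + k) \<in> X"
        using x(1) by (simp add: pseudo_orbit_def)
      ultimately show ?case
        using assms(5) by (simp add: add.commute)
    qed (simp add: x(2))
    define m j where "m = i div k" and "j = i mod k"
    have i: "i = m * k + j" and j: "j \<le> k"
      using k(1) by (simp_all add: m_def j_def less_imp_le)
    have "dist (x (m * k + j)) ((f ^^ j) p) < \<epsilon>"
      using \<delta>(2)[OF pseudo_orbit_shift[OF x(1)], of "m * k"] return[of m] j by simp
    moreover have "(f ^^ i) p = (f ^^ j) p"
      using funpow_mult_period[OF k(2), of m] unfolding i
      by (metis add.commute comp_apply funpow_add)
    ultimately show ?thesis
      by (simp add: i)
  qed
  then show ?thesis
    by (intro exI[of _ \<delta>] conjI allI impI \<delta>(1)) simp
qed

lemma isolated_point_dichotomy: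
  assumes "deterministic_shadowing X f" "f \<in> cont_self_maps X" "p \<in> X" "\<epsilon> > 0"
    and iso: "r > 0" "\<And>z. z \<in> X \<Longrightarrow> dist z p < r \<Longrightarrow> z = p"
  shows "\<exists>\<delta>>0. \<forall>x. pseudo_orbit X f \<delta> x \<and> x 0 = p \<longrightarrow>
    (if periodic_point f p then \<forall>i. dist (x i) ((f ^^ i) p) < \<epsilon> else \<forall>i>0. x i \<noteq> p)"
proof (cases "periodic_point f p")
  case True
  then show ?thesis
    using isolated_periodic_tracking[OF assms(2-6) True] by simp
next
  case False
  have "f ` X \<subseteq> X"
    using assms(2) by (auto simp: cont_self_maps_def)
  then obtain \<delta> where \<delta>: "\<delta> > 0"
    "\<forall>n x. n > 0 \<and> pseudo_orbit_segment X f \<delta> n x \<and> x 0 = p \<and> x n = p \<longrightarrow> periodic_point f p"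
    using isolated_return_imp_periodic[OF assms(1) iso] by blast
  have "x n \<noteq> p" if x: "pseudo_orbit X f \<delta> x" "x 0 = p" and "n > 0" for x n
  proof -
    have "pseudo_orbit_segment X f \<delta> n x"
      using x(1) by (simp add: pseudo_orbit_def pseudo_orbit_segment_def)
    then show ?thesis
      using \<delta>(2) x(2) that(3) False by blast
  qed
  then show ?thesis
    unfolding if_not_P[OF False] using \<delta>(1) by blast
qed

section \<open>Separating the points of a pseudo-orbit\<close>

text \<open>
  A ball of radius \<open>\<eta> / 2\<close> that contains one sparse point lies in the \<open>\<eta>\<close>-ball around that point, which
  meets \<open>X\<close> in a finite set; finitely many balls of radius \<open>\<eta> / 2\<close> cover \<open>X\<close>.
\<close>

lemma finite_sparse_points:
  assumes "compact X" "\<eta> > 0"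
  shows "finite {p\<in>X. finite (X \<inter> ball p \<eta>)}" (is "finite ?P")
proof -
  obtain C where C: "finite C" "X \<subseteq> (\<Union>c\<in>C. ball c (\<eta> / 2))"
    using assms(1) half_gt_zero[OF assms(2)] unfolding compact_eq_totally_bounded by meson
  have "finite (?P \<inter> ball c (\<eta> / 2))" for c
  proof (cases "?P \<inter> ball c (\<eta> / 2) = {}")
    case False
    then obtain p where p: "p \<in> ?P" "p \<in> ball c (\<eta> / 2)"
      by blast
    have "?P \<inter> ball c (\<eta> / 2) \<subseteq> X \<inter> ball p \<eta>"
      using p(2) dist_triangle_half_r[of c p \<eta>] by (auto simp del: less_divide_eq_numeral1)
    then show ?thesis
      using p(1) finite_subset by blast
  qed simp
  then have "finite (\<Union>c\<in>C. ?P \<inter> ball c (\<eta> / 2))"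
    using C(1) by blast
  then show ?thesis
    by (rule rev_finite_subset) (use C(2) in blast)
qed

lemma sparse_point_isolated:
  fixes p :: "'a::metric_space"
  assumes "finite (X \<inter> ball p \<eta>)" "\<eta> > 0"
  shows "\<exists>r>0. \<forall>z\<in>X. dist z p < r \<longrightarrow> z = p"
proof -
  obtain d where d: "d > 0" "\<forall>z\<in>X \<inter> ball p \<eta>. z \<noteq> p \<longrightarrow> d \<le> dist p z"
    using finite_set_avoid[OF assms(1)] by blast
  then show ?thesis
    using assms(2) by (intro exI[of _ "min d \<eta>"]) (force simp: dist_commute)
qed

lemma distinct_representatives:
  assumes "finite I" "\<And>i. i \<in> I \<Longrightarrow> infinite (A i)" "finite B"
  shows "\<exists>y. inj_on y I \<and> (\<forall>i\<in>I. y i \<in> A i - B)"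
  using assms(1,2)
proof (induction I)
  case (insert i I)
  then obtain y where y: "inj_on y I" "\<forall>i\<in>I. y i \<in> A i - B"
    by auto
  have "infinite (A i - (B \<union> y ` I))"
    using insert assms(3) by (intro Diff_infinite_finite) auto
  then obtain a where "a \<in> A i - (B \<union> y ` I)"
    by (meson finite.emptyI ex_in_conv finite_subset subsetI)
  then have "inj_on (y(i := a)) (insert i I) \<and> (\<forall>j\<in>insert i I. (y(i := a)) j \<in> A j - B)"
    using y insert(2) by (auto simp: inj_on_def)
  then show ?case by blast
qed simp

text \<open>
  \<open>T\<close> is the set of times from which on \<open>x\<close> is a true orbit, so repetitions within \<open>T\<close> are harmless.
  A point with only finitely many neighbours cannot be moved, and outside \<open>T\<close> it is assumed to occur
  at most once. Any other point visited outside \<open>T\<close> is moved to a place used at no other time.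
\<close>

lemma deterministic_approximation:
  assumes x: "pseudo_orbit X f (\<delta> / 3) x"
    and \<eta>: "0 < \<eta>" "\<eta> \<le> \<delta> / 3"
      "\<And>u v. u \<in> X \<Longrightarrow> v \<in> X \<Longrightarrow> dist u v < \<eta> \<Longrightarrow> dist (f u) (f v) < \<delta> / 3"
    and T: "\<forall>m\<in>T. Suc m \<in> T \<and> x (Suc m) = f (x m)"
    and repeat: "\<And>a b. a \<noteq> b \<Longrightarrow> x a = x b \<Longrightarrow> finite (X \<inter> ball (x a) \<eta>) \<Longrightarrow> a \<in> T"
  obtains y where "pseudo_orbit_segment X f \<delta> n y" "deterministic n y"
    "\<forall>i\<le>n. dist (x i) (y i) < \<eta>"
proof -
  \<comment> \<open>the times at which the point is moved\<close>
  define I where "I = {m. m \<le> n \<and> m \<notin> T \<and> infinite (X \<inter> ball (x m) \<eta>)}"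
  have "\<exists>w. inj_on w I \<and> (\<forall>i\<in>I. w i \<in> (X \<inter> ball (x i) \<eta>) - x ` {..n})"
    by (rule distinct_representatives) (simp_all add: I_def)
  then obtain w where w: "inj_on w I" "\<forall>i\<in>I. w i \<in> (X \<inter> ball (x i) \<eta>) - x ` {..n}"
    by blast
  define y where "y i = (if i \<in> I then w i else x i)" for i
  have xX: "x i \<in> X" and xstep: "dist (f (x i)) (x (Suc i)) < \<delta> / 3" for i
    using x by (auto simp: pseudo_orbit_def)
  have yX: "y i \<in> X" and close: "dist (x i) (y i) < \<eta>" for i
    using w(2) xX[of i] \<eta>(1) by (auto simp: y_def)
  have "dist (f (y i)) (y (Suc i)) < \<delta>" for i
  proof -
    have "dist (f (y i)) (f (x i)) < \<delta> / 3"
      using \<eta>(3)[OF yX[of i] xX[of i]] close[of i] by (simp add: dist_commute)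
    then show ?thesis
      using xstep[of i] close[of "Suc i"] \<eta>(2) dist_triangle[of "f (y i)" "y (Suc i)" "f (x i)"]
        dist_triangle[of "f (x i)" "y (Suc i)" "x (Suc i)"] by linarith
  qed
  then have seg: "pseudo_orbit_segment X f \<delta> n y"
    using yX by (simp add: pseudo_orbit_segment_def)
  have not_moved: "i \<notin> I" if "j < n" "y i = y j" "i \<noteq> j" for i j
  proof
    assume "i \<in> I"
    then have i: "y i = w i" "w i \<notin> x ` {..n}"
      using w(2) by (auto simp: y_def)
    have "j \<in> I"
    proof (rule ccontr)
      assume "j \<notin> I"
      then have "y j \<in> x ` {..n}"
        using that(1) by (simp add: y_def)
      then show False
        using i that(2) by simp
    qed
    then have "w i = w j"
      using i that(2) by (simp add: y_def)
    then show False
      using inj_onD[OF w(1)] \<open>i \<in> I\<close> \<open>j \<in> I\<close> that(3) by blast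
  qed
  have "y (Suc a) = y (Suc b)" if ab: "a < n" "b < n" "y a = y b" for a b
  proof (cases "a = b")
    case False
    have "a \<notin> I" "b \<notin> I"
      using not_moved[OF ab(2,3) False] not_moved[OF ab(1) ab(3)[symmetric]] False by auto
    then have eq: "x a = x b"
      using ab(3) by (simp add: y_def)
    have "a \<in> T" "b \<in> T"
      using \<open>a \<notin> I\<close> \<open>b \<notin> I\<close> eq repeat[of a b] repeat[of b a] False ab by (auto simp: I_def)
    then have "y (Suc a) = f (x a)" "y (Suc b) = f (x b)"
      using T by (auto simp: y_def I_def)
    then show ?thesis
      using eq by simp
  qed simp
  then have "deterministic n y"
    unfolding deterministic_def by blast
  then show thesis
    using seg close by (intro that[of y]) auto
qed

section \<open>From deterministic shadowing to shadowing\<close>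

text \<open>
  A limit point of the shadowing points for longer and longer pieces shadows the whole sequence.
\<close>

lemma shadowing_from_finite_segments:
  assumes "compact X" "f \<in> cont_self_maps X"
    and fin: "\<And>n. \<exists>z\<in>X. \<forall>i\<le>n. dist (x i) ((f ^^ i) z) \<le> c"
  shows "\<exists>z\<in>X. \<forall>i. dist (x i) ((f ^^ i) z) \<le> c"
proof -
  obtain z where z: "\<And>n. z n \<in> X" "\<And>n i. i \<le> n \<Longrightarrow> dist (x i) ((f ^^ i) (z n)) \<le> c"
    using fin by metis
  obtain l s where l: "l \<in> X" "strict_mono s" "(z \<circ> s) \<longlonglongrightarrow> l"
    using assms(1) z(1) unfolding compact_def by meson
  have "dist (x i) ((f ^^ i) l) \<le> c" for i
  proof -
    have "continuous_on X (f ^^ i)"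
      using continuous_on_funpow assms(2) by (auto simp: cont_self_maps_def)
    then have "(\<lambda>n. (f ^^ i) ((z \<circ> s) n)) \<longlonglongrightarrow> (f ^^ i) l"
      using l z(1) continuous_on_tendsto_compose[of X "f ^^ i" "z \<circ> s" l] by auto
    then have "(\<lambda>n. dist (x i) ((f ^^ i) ((z \<circ> s) n))) \<longlonglongrightarrow> dist (x i) ((f ^^ i) l)"
      by (intro tendsto_intros)
    moreover have "\<forall>n\<ge>i. dist (x i) ((f ^^ i) ((z \<circ> s) n)) \<le> c"
      using z(2) seq_suble[OF l(2)] by (metis comp_apply le_trans)
    ultimately show ?thesis
      using LIMSEQ_le_const2 by blast
  qed
  then show ?thesis
    using l(1) by blast
qed

lemma pseudo_orbit_join_periodic:
  assumes x: "pseudo_orbit X f \<delta> x" and "\<delta> > 0" "f ` X \<subseteq> X"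
  shows "pseudo_orbit X f \<delta> (\<lambda>m. if m \<le> t then x m else (f ^^ (m - t)) (x t))"
    (is "pseudo_orbit X f \<delta> ?y")
proof -
  have "dist (f (?y m)) (?y (Suc m)) < \<delta>" for m
  proof (cases "m < t")
    case True
    then show ?thesis
      using x by (auto simp: pseudo_orbit_def)
  next
    case False
    then have "f (?y m) = ?y (Suc m)"
      by (auto simp: Suc_diff_le)
    then show ?thesis
      using assms(2) by simp
  qed
  moreover have "?y m \<in> X" for m
    using x funpow_mem[OF assms(3)] by (auto simp: pseudo_orbit_def)
  ultimately show ?thesis
    by (simp add: pseudo_orbit_def)
qed

text \<open>
  The last assumption is the dichotomy, with one jump size \<open>\<delta>\<close> for all points of \<open>P\<close>. The new sequence
  follows \<open>f\<close> exactly from the first visit to a periodic point of \<open>P\<close> on. Since it is again a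
  \<open>\<delta>\<close>-pseudo-orbit, the dichotomy also applies to it: the points of \<open>P\<close> that it visits earlier, not
  being periodic, are visited only once.
\<close>

lemma exact_after_repeats:
  assumes x: "pseudo_orbit X f \<delta> x" and "\<delta> > 0" "\<epsilon> > 0" and self: "f ` X \<subseteq> X"
    and dich: "\<And>p u. p \<in> P \<Longrightarrow> pseudo_orbit X f \<delta> u \<Longrightarrow> u 0 = p \<Longrightarrow>
      (if periodic_point f p then \<forall>i. dist (u i) ((f ^^ i) p) < \<epsilon> else \<forall>i>0. u i \<noteq> p)"
  obtains x' T where "pseudo_orbit X f \<delta> x'" "\<forall>i. dist (x i) (x' i) < \<epsilon>"
    "\<forall>m\<in>T. Suc m \<in> T \<and> x' (Suc m) = f (x' m)"
    "\<forall>a b. a \<noteq> b \<and> x' a = x' b \<and> x' a \<in> P \<longrightarrow> a \<in> T"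
proof -
  have no_return: "u a \<noteq> u b"
    if u: "pseudo_orbit X f \<delta> u" and "a < b" "u a \<in> P" "\<not> periodic_point f (u a)" for u a b
    using dich[OF that(3) pseudo_orbit_shift[OF u, of a]] that
    by (auto dest!: spec[of _ "b - a"])
  have aperiodic: "u a \<noteq> u b"
    if "pseudo_orbit X f \<delta> u" "a \<noteq> b" "u a \<in> P" "\<not> periodic_point f (u a)" for u a b
    using no_return[of u a b] no_return[of u b a] that by (metis linorder_neqE_nat)
  show thesis
  proof (cases "\<exists>t. x t \<in> P \<and> periodic_point f (x t)")
    case False
    show thesis
    proof (rule that[of x "{}"])
      show "\<forall>a b. a \<noteq> b \<and> x a = x b \<and> x a \<in> P \<longrightarrow> a \<in> {}"
        using aperiodic[OF x] False by blast
    qed (use x assms(3) in auto)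
  next
    case True
    define t where "t = (LEAST t. x t \<in> P \<and> periodic_point f (x t))"
    have t: "x t \<in> P" "periodic_point f (x t)"
      using LeastI_ex[OF True] by (auto simp: t_def)
    have before_t: "\<not> periodic_point f (x m)" if "m < t" "x m \<in> P" for m
      using not_less_Least[of m] that by (auto simp: t_def)
    define x' where "x' m = (if m \<le> t then x m else (f ^^ (m - t)) (x t))" for m
    have x': "pseudo_orbit X f \<delta> x'"
      using pseudo_orbit_join_periodic[OF x assms(2) self, of t] by (simp add: x'_def[abs_def])
    show thesis
    proof (rule that[of x' "{t..}"])
      have "dist (x i) ((f ^^ (i - t)) (x t)) < \<epsilon>" if "t < i" for i
        using dich[OF t(1) pseudo_orbit_shift[OF x, of t]] t(2) that
        by (auto dest!: spec[of _ "i - t"])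
      then show "\<forall>i. dist (x i) (x' i) < \<epsilon>"
        using assms(3) by (auto simp: x'_def)
    next
      have "\<not> periodic_point f (x' a)" if "a \<notin> {t..}" "x' a \<in> P" for a
        using before_t[of a] that by (auto simp: x'_def)
      then show "\<forall>a b. a \<noteq> b \<and> x' a = x' b \<and> x' a \<in> P \<longrightarrow> a \<in> {t..}"
        using aperiodic[OF x'] by blast
    qed (use x' in \<open>auto simp: x'_def Suc_diff_le\<close>)
  qed
qed

text \<open>
  The accuracy \<open>\<epsilon>\<close> is shared by three errors of size \<open>e = \<epsilon> / 4\<close>: making the pseudo-orbit exact after
  a periodic visit, moving its points apart, and shadowing the deterministic result. A fourth of \<open>\<epsilon>\<close>
  remains because the passage to the limit loses the strictness of the inequality. The order of
  choices matters: \<open>\<eta>\<close> determines the finite set \<open>P\<close>, and the jump size \<open>\<delta>\<close> is chosen only after \<open>P\<close>.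
\<close>

lemma has_shadowingI:
  assumes "compact X" "f \<in> cont_self_maps X" "deterministic_shadowing X f"
  shows "has_shadowing X f"
  unfolding has_shadowing_def
proof (intro allI impI)
  fix \<epsilon> :: real assume "\<epsilon> > 0"
  define e where "e = \<epsilon> / 4"
  have e: "e > 0" "3 * e < \<epsilon>"
    using \<open>\<epsilon> > 0\<close> by (auto simp: e_def)
  have f: "continuous_on X f" "f ` X \<subseteq> X"
    using assms(2) by (auto simp: cont_self_maps_def)
  obtain \<delta>1 where \<delta>1: "\<delta>1 > 0" "\<And>n x. pseudo_orbit_segment X f \<delta>1 n x \<Longrightarrow> deterministic n x \<Longrightarrow>
      \<exists>z\<in>X. \<forall>i\<le>n. dist ((f ^^ i) z) (x i) < e"
    using assms(3) e(1) unfolding deterministic_shadowing_def by meson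
  have "uniformly_continuous_on X f"
    using compact_uniformly_continuous f(1) assms(1) by blast
  then obtain d where d: "d > 0"
    "\<And>u v. u \<in> X \<Longrightarrow> v \<in> X \<Longrightarrow> dist u v < d \<Longrightarrow> dist (f u) (f v) < \<delta>1 / 3"
    using \<delta>1(1) unfolding uniformly_continuous_on_def
    by (metis dist_commute zero_less_divide_iff zero_less_numeral)
  define \<eta> where "\<eta> = min d (min e (\<delta>1 / 3))"
  have \<eta>: "0 < \<eta>" "\<eta> \<le> \<delta>1 / 3" "\<eta> \<le> e"
    "\<And>u v. u \<in> X \<Longrightarrow> v \<in> X \<Longrightarrow> dist u v < \<eta> \<Longrightarrow> dist (f u) (f v) < \<delta>1 / 3"
    using d e(1) \<delta>1(1) by (auto simp: \<eta>_def)
  define P where "P = {p\<in>X. finite (X \<inter> ball p \<eta>)}"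
  have "finite P"
    using finite_sparse_points[OF assms(1) \<eta>(1)] by (simp add: P_def)
  \<comment> \<open>the conclusion of the dichotomy; it persists when \<open>\<delta>\<close> decreases\<close>
  define good where "good \<delta> p \<longleftrightarrow> (\<forall>x. pseudo_orbit X f \<delta> x \<and> x 0 = p \<longrightarrow>
    (if periodic_point f p then \<forall>i. dist (x i) ((f ^^ i) p) < e else \<forall>i>0. x i \<noteq> p))" for \<delta> p
  have "\<exists>\<delta>>0. good \<delta> p" if "p \<in> P" for p
  proof -
    have p: "p \<in> X" "finite (X \<inter> ball p \<eta>)"
      using that by (auto simp: P_def)
    obtain r where "r > 0" "\<forall>z\<in>X. dist z p < r \<longrightarrow> z = p"
      using sparse_point_isolated[OF p(2) \<eta>(1)] by blast
    then show ?thesis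
      unfolding good_def by (intro isolated_point_dichotomy[OF assms(3,2) p(1) e(1)]) auto
  qed
  then obtain D where D: "\<And>p. p \<in> P \<Longrightarrow> D p > 0 \<and> good (D p) p"
    by metis
  define \<delta> where "\<delta> = Min (insert (\<delta>1 / 3) (D ` P))"
  have "\<delta> > 0"
    unfolding \<delta>_def using \<open>finite P\<close> D \<delta>1(1) by (subst Min_gr_iff) auto
  have \<delta>_le: "\<delta> \<le> \<delta>1 / 3" "\<And>p. p \<in> P \<Longrightarrow> \<delta> \<le> D p"
    using \<open>finite P\<close> unfolding \<delta>_def by (intro Min_le; blast)+
  have dich: "if periodic_point f p then \<forall>i. dist (u i) ((f ^^ i) p) < e else \<forall>i>0. u i \<noteq> p"
    if "p \<in> P" "pseudo_orbit X f \<delta> u" "u 0 = p" for p u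
    using D[OF that(1)] pseudo_orbit_mono[OF that(2) \<delta>_le(2)[OF that(1)]] that(3)
    unfolding good_def by blast
  have "\<exists>z\<in>X. \<forall>i. dist (x i) ((f ^^ i) z) < \<epsilon>" if x: "pseudo_orbit X f \<delta> x" for x
  proof -
    obtain x' T where x': "pseudo_orbit X f \<delta> x'" "\<forall>i. dist (x i) (x' i) < e"
      and T: "\<forall>m\<in>T. Suc m \<in> T \<and> x' (Suc m) = f (x' m)"
      and repeat: "\<forall>a b. a \<noteq> b \<and> x' a = x' b \<and> x' a \<in> P \<longrightarrow> a \<in> T"
      by (rule exact_after_repeats[OF x \<open>\<delta> > 0\<close> e(1) f(2), of P])
        (rule dich)
    have x'3: "pseudo_orbit X f (\<delta>1 / 3) x'"
      using pseudo_orbit_mono[OF x'(1) \<delta>_le(1)] .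
    have "\<exists>z\<in>X. \<forall>i\<le>n. dist (x i) ((f ^^ i) z) \<le> 3 * e" for n
    proof -
      have sparse: "a \<in> T" if "a \<noteq> b" "x' a = x' b" "finite (X \<inter> ball (x' a) \<eta>)" for a b
      proof -
        have "x' a \<in> P"
          using that(3) x'(1) by (simp add: P_def pseudo_orbit_def)
        then show ?thesis
          using repeat that(1,2) by blast
      qed
      obtain y where y: "pseudo_orbit_segment X f \<delta>1 n y" "deterministic n y"
          "\<forall>i\<le>n. dist (x' i) (y i) < \<eta>"
        by (rule deterministic_approximation[OF x'3 \<eta>(1,2) _ T])
          (rule \<eta>(4), assumption+, rule sparse)
      obtain z where z: "z \<in> X" "\<forall>i\<le>n. dist ((f ^^ i) z) (y i) < e"
        using \<delta>1(2)[OF y(1,2)] by blast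
      have "dist (x i) ((f ^^ i) z) \<le> 3 * e" if "i \<le> n" for i
        using x'(2)[rule_format, of i] y(3)[rule_format, OF that] z(2)[rule_format, OF that] \<eta>(3)
          dist_triangle[of "x i" "(f ^^ i) z" "x' i"] dist_triangle[of "x' i" "(f ^^ i) z" "y i"]
          dist_commute[of "y i" "(f ^^ i) z"] by linarith
      then show ?thesis
        using z(1) by blast
    qed
    then obtain z where "z \<in> X" "\<forall>i. dist (x i) ((f ^^ i) z) \<le> 3 * e"
      using shadowing_from_finite_segments[OF assms(1,2)] by blast
    then show ?thesis
      using e(2) by (meson le_less_trans)
  qed
  then show "\<exists>\<delta>>0. \<forall>x. pseudo_orbit X f \<delta> x \<longrightarrow> (\<exists>z\<in>X. \<forall>i. dist (x i) ((f ^^ i) z) < \<epsilon>)"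
    using \<open>\<delta> > 0\<close> by blast
qed

section \<open>Shadowing and perturbations of the map\<close>

lemma perturbed_orbit_pseudo_orbit:
  assumes "g \<in> cont_self_maps X" "sup_dist X g f < ennreal \<delta>" "y \<in> X"
  shows "pseudo_orbit X f \<delta> (orbit_seq g y)"
proof -
  have mem: "(g ^^ i) y \<in> X" for i
    using funpow_mem[of g X y] assms by (auto simp: cont_self_maps_def)
  have "dist (f ((g ^^ i) y)) (g ((g ^^ i) y)) < \<delta>" for i
    using sup_dist_lessD[OF assms(2) mem] by (simp add: dist_commute)
  then show ?thesis
    using mem by (simp add: pseudo_orbit_def orbit_seq_def)
qed

theorem theorem18:
  fixes X :: "'a::metric_space set" and f :: "'a \<Rightarrow> 'a"
  assumes "compact X" and "perturbable X" and "f \<in> cont_self_maps X"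
  shows "has_shadowing X f \<longleftrightarrow>
    (\<forall>\<epsilon>::real. \<epsilon> > 0 \<longrightarrow>
      (\<exists>\<delta>::real. \<delta> > 0 \<and>
        (\<forall>g \<in> cont_self_maps X. sup_dist X g f < ennreal \<delta> \<longrightarrow>
          (\<forall>y\<in>X. \<exists>z\<in>X. shadows \<epsilon> (orbit_seq f z) (orbit_seq g y)))))"
  (is "_ \<longleftrightarrow> ?stable")
proof
  assume sh: "has_shadowing X f"
  show ?stable
  proof (intro allI impI)
    fix \<epsilon> :: real assume "\<epsilon> > 0"
    then obtain \<delta> where "\<delta> > 0"
      and \<delta>: "\<And>x. pseudo_orbit X f \<delta> x \<Longrightarrow> \<exists>z\<in>X. \<forall>i. dist (x i) ((f ^^ i) z) < \<epsilon>"
      using sh unfolding has_shadowing_def by meson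
    have "\<exists>z\<in>X. shadows \<epsilon> (orbit_seq f z) (orbit_seq g y)"
      if "g \<in> cont_self_maps X" "sup_dist X g f < ennreal \<delta>" "y \<in> X" for g y
      using \<delta>[OF perturbed_orbit_pseudo_orbit[OF that]]
      by (simp add: shadows_def orbit_seq_def dist_commute)
    then show "\<exists>\<delta>>0. \<forall>g\<in>cont_self_maps X. sup_dist X g f < ennreal \<delta> \<longrightarrow>
          (\<forall>y\<in>X. \<exists>z\<in>X. shadows \<epsilon> (orbit_seq f z) (orbit_seq g y))"
      using \<open>\<delta> > 0\<close> by blast
  qed
next
  assume ?stable
  then have "deterministic_shadowing X f"
    by (intro deterministic_shadowingI[OF assms(2,3)]) blast
  then show "has_shadowing X f"
    using has_shadowingI assms(1,3) by blast
qed

end
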